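(* Let $\gamma$ be a strictly positive integer, $t\ge2\gamma+3$ an integer, and $N\ge3\gamma$ an integer. The staircase semigroup $S_N=S_N(t)$ is minimally generated by $$\{2N,(2\gamma+1)N,N(t+1)-1\}\sqcup\{N(t-1)j-j+(2\gamma+1)N\}_{j=1}^{\gamma}\sqcup\{Ntj+N\gamma-j\}_{j=\gamma+1}^{N-\gamma}\sqcup\{N(t-1)j+N^2-j\}_{j=N-\gamma+1}^{N-1}.$$
   Context: For a numerical semigroup $S$ (cofinite submonoid of $\mathbb N$) containing $2N$, the standard basis modulo $2N$ is $(e_0=2N,e_1,\dots,e_{2N-1})$, with $e_i$ ($i\ge1$) the smallest nonzero element of $S$ congruent to $i$ modulo $2N$. The staircase semigroup $S_N(t)$ is the numerical semigroup with $e_0=2N$, $e_N=(2\gamma+1)N$, and whose remaining standard basis elements modulo $2N$ are determined by $$\min\{e_{N-j},e_{2N-j}\}=(Nt-1)j+N\epsilon_j,\qquad e_{N-j}+e_{2N-j}=2j(Nt-1)+(2\gamma+1)N\qquad(j=1,\dots,N-1),$$ where $(\epsilon_1,\dots,\epsilon_N)=(1,2,\dots,\gamma-1,\gamma,\dots,\gamma,\gamma-1,\dots,2,1,0)$, i.e. $\epsilon_j=\min\{j,\gamma,N-j\}$. *)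

theory Defs
  imports Main "HOL.Hull"
begin

definition is_submonoid :: "nat set \<Rightarrow> bool" where
  "is_submonoid S \<longleftrightarrow> 0 \<in> S \<and> (\<forall>x\<in>S. \<forall>y\<in>S. x + y \<in> S)"

definition numerical_semigroup :: "nat set \<Rightarrow> bool" where
  "numerical_semigroup S \<longleftrightarrow> is_submonoid S \<and> finite (- S)"

definition minimally_generated_by :: "nat set \<Rightarrow> nat set \<Rightarrow> bool" where
  "minimally_generated_by S G \<longleftrightarrow>
     is_submonoid hull G = S \<and> (\<forall>H. H \<subset> G \<longrightarrow> is_submonoid hull H \<noteq> S)"

text \<open>Entry \<open>i\<close> of the standard basis of \<open>S\<close> modulo \<open>m\<close>, meant for \<open>m \<in> S\<close>, \<open>m > 0\<close> and \<open>i < m\<close>.\<close>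

definition standard_basis :: "nat set \<Rightarrow> nat \<Rightarrow> nat \<Rightarrow> nat" where
  "standard_basis S m i =
     (if i = 0 then m else (LEAST s. s \<in> S \<and> s \<noteq> 0 \<and> s mod m = i mod m))"

definition staircase_eps :: "nat \<Rightarrow> nat \<Rightarrow> nat \<Rightarrow> nat" where
  "staircase_eps \<gamma> N j = min j (min \<gamma> (N - j))"

text \<open>
  The subtractions on \<open>nat\<close> below do not truncate when \<open>N, t > 0\<close>.
  The condition on entry \<open>0\<close>, namely \<open>e\<^sub>0 = 2N\<close>, is built into \<^const>\<open>standard_basis\<close>.
\<close>

definition is_staircase_semigroup :: "nat \<Rightarrow> nat \<Rightarrow> nat \<Rightarrow> nat set \<Rightarrow> bool" where
  "is_staircase_semigroup \<gamma> N t S \<longleftrightarrow>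
     numerical_semigroup S \<and> 2 * N \<in> S \<and>
     (let e = standard_basis S (2 * N) in
        e N = (2 * \<gamma> + 1) * N \<and>
        (\<forall>j\<in>{1..N - 1}.
           min (e (N - j)) (e (2 * N - j)) = (N * t - 1) * j + N * staircase_eps \<gamma> N j \<and>
           e (N - j) + e (2 * N - j) = 2 * j * (N * t - 1) + (2 * \<gamma> + 1) * N))"

text \<open>
  The conditions prescribe each pair \<open>{e\<^bsub>N-j\<^esub>, e\<^bsub>2N-j\<^esub>}\<close>, and the residues modulo \<open>2N\<close> tell its
  members apart, so for \<open>N, t > 0\<close> at most one semigroup satisfies them. One exists whenever
  \<open>\<gamma> > 0\<close>, \<open>t \<ge> 2\<gamma> + 3\<close> and \<open>N \<ge> 3\<gamma>\<close>.
\<close>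

definition staircase_semigroup :: "nat \<Rightarrow> nat \<Rightarrow> nat \<Rightarrow> nat set" where
  "staircase_semigroup \<gamma> N t = (THE S. is_staircase_semigroup \<gamma> N t S)"

end

theory Submission
  imports Defs
begin

text \<open>
  Every natural number is \<open>N a - j\<close> for exactly one \<open>j < N\<close>, and its residue modulo \<open>2N\<close> records
  \<open>j\<close> together with the parity of \<open>a\<close>. Put \<open>a = t j + b\<close>; the pair \<open>(j, b)\<close> is a coordinate system
  in which addition is componentwise, as long as the first coordinates do not add up to \<open>N\<close> or more
  (\<open>cell_add\<close>, \<open>cell_wrap\<close>). The two prescribed basis elements with first coordinate \<open>j\<close> have
  heights \<open>b = \<epsilon>\<^sub>j\<close> and \<open>b = 2\<gamma> + 1 - \<epsilon>\<^sub>j\<close>, which have opposite parity; for \<open>j = 0\<close> these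
  formulas give \<open>0\<close> and \<open>(2\<gamma> + 1) N\<close>. Hence \<open>S\<^sub>N(t)\<close>
  consists of the points \<open>(j, b)\<close> for which \<open>b\<close> lies above the prescribed height of its own parity,
  and \<open>t\<close> no longer enters, except that a sum that wraps around gains the huge height \<open>t N - 1\<close>.

  That this set is a semigroup comes from two properties of \<open>\<epsilon>\<close>, the truncation at \<open>\<gamma>\<close> of the
  distance to \<open>0\<close> on the circle \<open>\<int>/N\<close>: the triangle inequality, and the fact that for three points with
  sum zero on that circle the sum of the three values is even or at least \<open>2\<gamma> + 1\<close>
  (\<open>eps_perimeter\<close>). The latter rests on \<open>N \<ge> 3\<gamma>\<close>.

  In coordinates the proposed generators are \<open>(0, 2)\<close>, \<open>(0, 2\<gamma> + 1)\<close>, \<open>(1, 1)\<close>, the upper points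
  \<open>(j, 2\<gamma> + 1 - j)\<close> for \<open>1 \<le> j \<le> \<gamma>\<close> and the lower points \<open>(j, \<epsilon>\<^sub>j)\<close> for \<open>\<gamma> < j < N\<close>. Any other
  nonzero point stays in the set when \<open>(0, 2)\<close> or \<open>(1, 1)\<close> is subtracted (\<open>generator_or_step\<close>), so
  these elements generate. None of them is a sum of two nonzero members (\<open>generator_irreducible\<close>):
  a wrapped sum is too high, a lower point with \<open>j > \<gamma>\<close> lies where the triangle inequality is
  strict, and an upper point with \<open>j \<le> \<gamma>\<close> has the wrong parity to be a sum of two lower ones. A
  generating set of irreducible elements is minimal.
\<close>

section \<open>Standard bases and minimal generation\<close>

lemma is_submonoid_hull: "is_submonoid (is_submonoid hull G)"
  by (rule hull_in) (auto simp: is_submonoid_def)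

lemma submonoid_mult:
  assumes "is_submonoid S" "m \<in> S"
  shows "m * k \<in> S"
  using assms by (induction k) (auto simp: is_submonoid_def)

text \<open>
  Removing an irreducible element from a submonoid leaves a submonoid, which therefore contains
  the hull of every subset of the generators that omits this element.
\<close>

lemma minimally_generated_by_irreducibles:
  assumes S: "is_submonoid S" and gen: "is_submonoid hull G = S" and "0 \<notin> G"
    and irr: "\<And>g x y. g \<in> G \<Longrightarrow> x \<in> S \<Longrightarrow> y \<in> S \<Longrightarrow> x + y = g \<Longrightarrow> x = 0 \<or> y = 0"
  shows "minimally_generated_by S G"
  unfolding minimally_generated_by_def
proof (intro conjI allI impI)
  show "is_submonoid hull G = S" by (fact gen)
  fix H assume "H \<subset> G"
  then obtain g where g: "g \<in> G" "g \<notin> H" by blast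
  have GS: "G \<subseteq> S" using hull_subset[of G is_submonoid] gen by simp
  have "is_submonoid (S - {g})"
    unfolding is_submonoid_def
  proof (intro conjI ballI)
    have "g \<noteq> 0" using g \<open>0 \<notin> G\<close> by metis
    then show "0 \<in> S - {g}" using S by (simp add: is_submonoid_def)
    fix x y assume xy: "x \<in> S - {g}" "y \<in> S - {g}"
    then have "x + y \<in> S" using S by (simp add: is_submonoid_def)
    moreover have "x + y \<noteq> g" using irr[OF g(1), of x y] xy by auto
    ultimately show "x + y \<in> S - {g}" by simp
  qed
  then have "is_submonoid hull H \<subseteq> S - {g}"
    using \<open>H \<subset> G\<close> GS g by (intro hull_minimal) auto
  then show "is_submonoid hull H \<noteq> S" using g GS by blast
qed

lemma standard_basis_properties:
  assumes "numerical_semigroup S" "0 < m" "0 < i" "i < m"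
  shows "standard_basis S m i \<in> S" "standard_basis S m i \<noteq> 0" "standard_basis S m i mod m = i"
    and "\<And>s. s \<in> S \<Longrightarrow> s \<noteq> 0 \<Longrightarrow> s mod m = i \<Longrightarrow> standard_basis S m i \<le> s"
proof -
  let ?P = "\<lambda>s. s \<in> S \<and> s \<noteq> 0 \<and> s mod m = i mod m"
  obtain B where B: "\<And>x. x \<notin> S \<Longrightarrow> x < B"
    using assms(1) unfolding numerical_semigroup_def finite_nat_set_iff_bounded by auto
  have "?P (i + m * B)"
  proof (intro conjI)
    have "B \<le> m * B" using assms(2) by simp
    then have "\<not> i + m * B < B" by linarith
    then show "i + m * B \<in> S" using B by blast
  qed (use assms in auto)
  then have "?P (LEAST s. ?P s)" by (rule LeastI)
  then show "standard_basis S m i \<in> S" "standard_basis S m i \<noteq> 0" "standard_basis S m i mod m = i"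
    using assms by (auto simp: standard_basis_def)
  show "standard_basis S m i \<le> s" if "s \<in> S" "s \<noteq> 0" "s mod m = i" for s
    using that assms by (auto simp: standard_basis_def intro: Least_le)
qed

lemma mem_iff_standard_basis_le:
  assumes "numerical_semigroup S" "0 < m" "m \<in> S" "x mod m \<noteq> 0"
  shows "x \<in> S \<longleftrightarrow> standard_basis S m (x mod m) \<le> x"
proof
  let ?e = "standard_basis S m (x mod m)"
  note e = standard_basis_properties[OF assms(1,2), of "x mod m"]
  show "?e \<le> x" if "x \<in> S"
    using that e(4)[of x] assms by (cases "x = 0") auto
  assume "?e \<le> x"
  moreover have "?e mod m = x mod m" using e(3) assms by simp
  ultimately obtain k where "x = ?e + m * k"
    using mod_eq_iff_dvd_symdiff_nat by (metis dvd_def le_add_diff_inverse mod_eq_dvd_iff_nat)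
  moreover have "?e \<in> S" "m * k \<in> S"
    using e(1) assms submonoid_mult by (auto simp: numerical_semigroup_def)
  ultimately show "x \<in> S"
    using assms(1) unfolding numerical_semigroup_def is_submonoid_def by metis
qed

text \<open>
  The minimum and the sum of a pair determine it up to order, and the residues fix the order.
\<close>

lemma staircase_basis_unique:
  assumes S: "is_staircase_semigroup \<gamma> N t S" and S': "is_staircase_semigroup \<gamma> N t S'"
    and "0 < N" "0 < i" "i < 2 * N"
  shows "standard_basis S (2 * N) i = standard_basis S' (2 * N) i"
proof -
  let ?e = "standard_basis S (2 * N)" and ?e' = "standard_basis S' (2 * N)"
  have num: "numerical_semigroup S" "numerical_semigroup S'"
    using S S' by (auto simp: is_staircase_semigroup_def)
  note e = standard_basis_properties(3)[OF num(1), of "2 * N"]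
  note e' = standard_basis_properties(3)[OF num(2), of "2 * N"]
  have pair: "?e (N - j) = ?e' (N - j) \<and> ?e (2 * N - j) = ?e' (2 * N - j)" if j: "j \<in> {1..N - 1}" for j
  proof -
    have "min (?e (N - j)) (?e (2 * N - j)) = min (?e' (N - j)) (?e' (2 * N - j))"
      "?e (N - j) + ?e (2 * N - j) = ?e' (N - j) + ?e' (2 * N - j)"
      using S S' j by (auto simp: is_staircase_semigroup_def Let_def)
    then have "(?e (N - j) = ?e' (N - j) \<and> ?e (2 * N - j) = ?e' (2 * N - j)) \<or>
        ?e (N - j) = ?e' (2 * N - j)"
      by (auto simp: min_def split: if_splits)
    moreover have "?e (N - j) mod (2 * N) = N - j" "?e' (2 * N - j) mod (2 * N) = 2 * N - j"
      using j \<open>0 < N\<close> by (auto intro!: e e')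
    moreover have "N - j \<noteq> 2 * N - j" using j by auto
    ultimately show ?thesis by metis
  qed
  consider "i = N" | "i < N" | "N < i" by linarith
  then show ?thesis
  proof cases
    case 1
    then show ?thesis using S S' by (auto simp: is_staircase_semigroup_def Let_def)
  next
    case 2
    then have "N - i \<in> {1..N - 1}" using assms by auto
    then show ?thesis using pair[of "N - i"] 2 by simp
  next
    case 3
    then have "2 * N - i \<in> {1..N - 1}" using assms by auto
    then show ?thesis using pair[of "2 * N - i"] assms by simp
  qed
qed

lemma is_staircase_semigroup_unique:
  assumes S: "is_staircase_semigroup \<gamma> N t S" and S': "is_staircase_semigroup \<gamma> N t S'" and "0 < N"
  shows "S = S'"
proof (rule set_eqI)
  fix x
  have num: "numerical_semigroup S" "2 * N \<in> S" "numerical_semigroup S'" "2 * N \<in> S'"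
    using S S' by (auto simp: is_staircase_semigroup_def)
  show "x \<in> S \<longleftrightarrow> x \<in> S'"
  proof (cases "x mod (2 * N) = 0")
    case True
    then obtain k where "x = 2 * N * k" by auto
    then show ?thesis using num submonoid_mult by (auto simp: numerical_semigroup_def)
  next
    case False
    moreover have "0 < 2 * N" using \<open>0 < N\<close> by simp
    ultimately show ?thesis
      using staircase_basis_unique[OF S S' \<open>0 < N\<close>, of "x mod (2 * N)"]
        mem_iff_standard_basis_le[OF num(1) _ num(2), of x] mem_iff_standard_basis_le[OF num(3) _ num(4), of x]
      by (metis mod_less_divisor neq0_conv)
  qed
qed

section \<open>The coordinates\<close>

locale staircase_parameters =
  fixes \<gamma> t N :: nat
  assumes gamma_pos: "\<gamma> > 0" and t_ge: "t \<ge> 2 * \<gamma> + 3" and N_ge: "N \<ge> 3 * \<gamma>"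
begin

abbreviation eps :: "nat \<Rightarrow> nat" where
  "eps \<equiv> staircase_eps \<gamma> N"

text \<open>
  The number \<open>N a - j\<close> with \<open>a = t j + b\<close>. The shift of \<open>a\<close> by \<open>t j\<close> makes the lower prescribed
  height equal to \<open>\<epsilon>\<^sub>j\<close>.
\<close>

definition cell :: "nat \<Rightarrow> nat \<Rightarrow> nat" where
  "cell j b = N * (t * j + b) - j"

lemma N_ge_3: "N \<ge> 3"
  using gamma_pos N_ge by linarith

lemma cell_plus: "cell j b + j = N * (t * j + b)"
proof -
  have "j \<le> N * (t * j + b)"
    using N_ge_3 t_ge by (intro order.trans[OF _ mult_le_mono[of 1 N j]]) (auto intro: trans_le_add1)
  then show ?thesis by (simp add: cell_def)
qed

lemma cell_add: "cell j b + cell k c = cell (j + k) (b + c)"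
proof -
  have "cell j b + cell k c + (j + k) = cell (j + k) (b + c) + (j + k)"
    unfolding cell_plus using cell_plus[of j b] cell_plus[of k c] by (simp add: algebra_simps)
  then show ?thesis by linarith
qed

lemma tN_ge: "t * N \<ge> 2 * \<gamma> + 3"
proof -
  have "t * 1 \<le> t * N" using N_ge_3 by (intro mult_le_mono2) simp
  then show ?thesis using t_ge by linarith
qed

text \<open>
  Lowering \<open>j\<close> by \<open>N\<close> takes \<open>t N\<close> away from \<open>t j\<close>, which the height has to make up for, and
  raises \<open>- j\<close> by one multiple of \<open>N\<close>, which accounts for the \<open>- 1\<close>.
\<close>

lemma cell_wrap:
  assumes "N \<le> j"
  shows "cell j b = cell (j - N) (b + t * N - 1)"
proof -
  obtain i where i: "j = N + i" using assms le_Suc_ex by blast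
  obtain h where h: "t * N = Suc h" using tN_ge by (cases "t * N") auto
  have "cell j b + j = cell i (b + h) + j"
  proof -
    have "t * N + t * i + b = t * i + (b + h) + 1" using h by simp
    then have "cell j b + j = N * (t * i + (b + h) + 1)"
      unfolding cell_plus i by (simp add: add_mult_distrib2)
    also have "\<dots> = cell i (b + h) + j"
      using cell_plus[of i "b + h"] i by (simp add: add_mult_distrib2)
    finally show ?thesis .
  qed
  then show ?thesis using i h by simp
qed

lemma cell_mod:
  assumes "j < N"
  shows "cell j b mod (2 * N) =
    (if j = 0 then (if even b then 0 else N) else if even (t * j + b) then 2 * N - j else N - j)"
proof -
  have N: "N > 0" using N_ge_3 by simp
  show ?thesis
  proof (cases "even (t * j + b)")
    case True
    then obtain q where q: "t * j + b = 2 * q" by blast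
    show ?thesis
    proof (cases "j = 0")
      case True
      then show ?thesis using q by (simp add: cell_def mult.left_commute[of N])
    next
      case False
      have "q \<noteq> 0" using q False t_ge by (cases q) auto
      then obtain r where r: "q = Suc r" by (cases q) auto
      have "cell j b = 2 * N * r + (2 * N - j)"
        using cell_plus[of j b] assms unfolding q r by (simp add: algebra_simps)
      moreover have "2 * N - j < 2 * N" using False assms by simp
      ultimately have "cell j b mod (2 * N) = 2 * N - j" by (metis mod_less mod_mult_self4)
      then show ?thesis using True False by simp
    qed
  next
    case False
    then obtain q where q: "t * j + b = 2 * q + 1" by (elim oddE)
    have "cell j b = 2 * N * q + (N - j)"
      using cell_plus[of j b] assms unfolding q by (simp add: algebra_simps)
    moreover have "N - j < 2 * N" using N by linarith
    ultimately have "cell j b mod (2 * N) = N - j" by (metis mod_less mod_mult_self4)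
    then show ?thesis using False by auto
  qed
qed

lemma cell_mod_eq_iff:
  assumes "j < N" "k < N"
  shows "cell j b mod (2 * N) = cell k c mod (2 * N) \<longleftrightarrow> j = k \<and> even (b + c)"
proof (cases "j = k")
  case True
  then show ?thesis using assms by (auto simp: cell_mod)
next
  case False
  then show ?thesis using assms by (auto simp: cell_mod)
qed

lemma cell_le_iff: "cell j b \<le> cell j c \<longleftrightarrow> b \<le> c"
proof -
  have "cell j b \<le> cell j c \<longleftrightarrow> N * (t * j + b) \<le> N * (t * j + c)"
    using cell_plus[of j b] cell_plus[of j c] by linarith
  then show ?thesis using N_ge_3 by simp
qed

lemma cell_eq_iff:
  assumes "j < N" "k < N"
  shows "cell j b = cell k c \<longleftrightarrow> j = k \<and> b = c"
proof
  assume eq: "cell j b = cell k c"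
  then have "j = k" using cell_mod_eq_iff[OF assms, of b c] by simp
  then show "j = k \<and> b = c" using eq cell_le_iff[of k b c] cell_le_iff[of k c b] by simp
qed auto

lemma cell_0_0: "cell 0 0 = 0"
  by (simp add: cell_def)

section \<open>The semigroup of admissible points\<close>

text \<open>
  The point \<open>(j, b)\<close> is admissible if \<open>b\<close> is at least the one of the two heights \<open>\<epsilon>\<^sub>j\<close> and
  \<open>2\<gamma> + 1 - \<epsilon>\<^sub>j\<close> that has the parity of \<open>b\<close>. As \<open>\<epsilon>\<^sub>j\<close> is the smaller one, the parity need only be
  asked for below \<open>2\<gamma> + 1 - \<epsilon>\<^sub>j\<close>.
\<close>

definition admissible :: "nat \<Rightarrow> nat \<Rightarrow> bool" where
  "admissible j b \<longleftrightarrow> eps j \<le> b \<and> even (b + eps j) \<or> 2 * \<gamma> + 1 \<le> b + eps j"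

definition staircase_points :: "nat set" where
  "staircase_points = {cell j b | j b. j < N \<and> admissible j b}"

lemma cell_in_staircase_points: "j < N \<Longrightarrow> cell j b \<in> staircase_points \<longleftrightarrow> admissible j b"
  unfolding staircase_points_def using cell_eq_iff by auto

lemma eps_le: "eps j \<le> \<gamma>"
  by (simp add: staircase_eps_def)

lemma eps_0: "eps 0 = 0"
  by (simp add: staircase_eps_def)

lemma admissible_ge_eps: "admissible j b \<Longrightarrow> eps j \<le> b"
  using eps_le[of j] by (auto simp: admissible_def)

lemma eps_triangle:
  assumes "j + k < N"
  shows "eps (j + k) \<le> eps j + eps k" "eps j \<le> eps k + eps (j + k)"
  using assms by (auto simp: staircase_eps_def min_def split: if_splits)

text \<open>
  If one of the three values is \<open>\<gamma>\<close>, the other two add up to at least \<open>\<gamma>\<close> by the triangle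
  inequality, so the total is \<open>2\<gamma>\<close> or more. Otherwise all three are untruncated distances: the arcs
  between the points \<open>0\<close>, \<open>j\<close>, \<open>j + k\<close> either cancel, leaving an even sum, or go once around the
  circle, which is impossible for three arcs shorter than \<open>\<gamma>\<close> because \<open>N \<ge> 3\<gamma>\<close>.
\<close>

lemma eps_perimeter:
  assumes "j + k < N"
  shows "even (eps j + eps k + eps (j + k)) \<or> 2 * \<gamma> + 1 \<le> eps j + eps k + eps (j + k)"
proof (cases "eps j = \<gamma> \<or> eps k = \<gamma> \<or> eps (j + k) = \<gamma>")
  case True
  have "k + j < N" using assms by simp
  then have "2 * \<gamma> \<le> eps j + eps k + eps (j + k)"
    using True eps_triangle[OF assms] eps_triangle(2)[of k j] by (auto simp: add.commute)
  then show ?thesis by (cases "2 * \<gamma> = eps j + eps k + eps (j + k)") (metis dvd_triv_left, linarith)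
next
  case False
  have untruncated: "eps i = i \<and> i < \<gamma> \<or> eps i = N - i \<and> N < i + \<gamma>" if "eps i \<noteq> \<gamma>" for i
    using that by (auto simp: staircase_eps_def min_def split: if_splits)
  have "eps j = j \<and> eps k = k \<and> eps (j + k) = j + k \<or>
      eps j = j \<and> eps k = N - k \<and> eps (j + k) = N - (j + k) \<or>
      eps j = N - j \<and> eps k = k \<and> eps (j + k) = N - (j + k)"
  proof -
    from False have "eps j \<noteq> \<gamma>" "eps k \<noteq> \<gamma>" "eps (j + k) \<noteq> \<gamma>" by auto
    from this[THEN untruncated] assms N_ge show ?thesis by (elim disjE) auto
  qed
  then consider "eps j + eps k + eps (j + k) = 2 * (j + k)" | "eps j + eps k + eps (j + k) = 2 * (N - k)"
    | "eps j + eps k + eps (j + k) = 2 * (N - j)"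
  proof (elim disjE conjE)
    assume "eps j = j" "eps k = N - k" "eps (j + k) = N - (j + k)"
    then have "eps j + eps k + eps (j + k) = 2 * (N - k)" using assms by linarith
    then show ?thesis by (rule that(2))
  next
    assume "eps j = N - j" "eps k = k" "eps (j + k) = N - (j + k)"
    then have "eps j + eps k + eps (j + k) = 2 * (N - j)" using assms by linarith
    then show ?thesis by (rule that(3))
  qed (use that(1) in simp)
  then show ?thesis by cases simp_all
qed

lemma admissible_add:
  assumes "j + k < N" "admissible j b" "admissible k c"
  shows "admissible (j + k) (b + c)"
proof -
  note ge = admissible_ge_eps[OF assms(2)] admissible_ge_eps[OF assms(3)]
  note tri = eps_triangle[OF assms(1)] eps_triangle(2)[of k j]
  consider "2 * \<gamma> + 1 \<le> b + eps j" | "2 * \<gamma> + 1 \<le> c + eps k"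
    | "even (b + eps j)" "even (c + eps k)"
    using assms by (auto simp: admissible_def)
  then show ?thesis
  proof cases
    case 1
    then show ?thesis using ge tri by (simp add: admissible_def)
  next
    case 2
    then show ?thesis using ge tri assms(1) by (simp add: admissible_def add.commute)
  next
    case 3
    from eps_perimeter[OF assms(1)] show ?thesis
    proof
      assume "even (eps j + eps k + eps (j + k))"
      then have "even (b + c + eps (j + k))" using 3 by auto
      then show ?thesis using ge tri by (simp add: admissible_def)
    next
      assume "2 * \<gamma> + 1 \<le> eps j + eps k + eps (j + k)"
      then show ?thesis using ge by (simp add: admissible_def)
    qed
  qed
qed

lemma staircase_points_submonoid: "is_submonoid staircase_points"
  unfolding is_submonoid_def
proof (intro conjI ballI)
  have "admissible 0 0" by (simp add: admissible_def eps_0)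
  then have "cell 0 0 \<in> staircase_points" using N_ge_3 by (simp add: cell_in_staircase_points)
  then show "0 \<in> staircase_points" by (simp only: cell_0_0)
  fix x y assume "x \<in> staircase_points" "y \<in> staircase_points"
  then obtain j b k c where x: "x = cell j b" "j < N" "admissible j b"
    and y: "y = cell k c" "k < N" "admissible k c" by (auto simp: staircase_points_def)
  show "x + y \<in> staircase_points"
  proof (cases "j + k < N")
    case True
    then show ?thesis using x y cell_add cell_in_staircase_points admissible_add by simp
  next
    case False
    have "x + y = cell (j + k - N) (b + c + t * N - 1)"
      using x y False by (simp add: cell_add cell_wrap)
    moreover have "admissible (j + k - N) (b + c + t * N - 1)"
      using tN_ge by (auto simp: admissible_def)
    moreover have "j + k - N < N" using x y by simp
    ultimately show ?thesis by (simp add: cell_in_staircase_points)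
  qed
qed

lemma staircase_points_numerical: "numerical_semigroup staircase_points"
proof -
  have "x \<in> staircase_points" if "x \<ge> N * (t * N + 2 * \<gamma> + 1)" for x
  proof -
    have N: "N > 0" using N_ge_3 by simp
    \<comment> \<open>the quotient of \<open>x\<close> by \<open>N\<close>, rounded up\<close>
    define a where "a = (x + N - 1) div N"
    have "x + N - 1 = N * a + (x + N - 1) mod N" by (simp add: a_def)
    moreover have "(x + N - 1) mod N < N" using N by simp
    ultimately have a: "x \<le> N * a" "N * a < x + N" using N by linarith+
    define j where "j = N * a - x"
    have j: "j < N" "x + j = N * a" using a by (auto simp: j_def)
    have "N * (t * N + 2 * \<gamma> + 1) \<le> N * a" using a that by linarith
    then have "t * N + 2 * \<gamma> + 1 \<le> a" using N nat_mult_le_cancel1 by blast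
    moreover have "t * j \<le> t * N" using j by simp
    ultimately have "t * j + (2 * \<gamma> + 1) \<le> a" by linarith
    then obtain b where b: "a = t * j + b" "2 * \<gamma> + 1 \<le> b"
      by (metis add.assoc le_Suc_ex le_add1)
    have "x = cell j b" using j b cell_plus[of j b] by simp
    then show ?thesis using j b by (simp add: cell_in_staircase_points admissible_def)
  qed
  then have "- staircase_points \<subseteq> {..< N * (t * N + 2 * \<gamma> + 1)}"
    by (auto simp: not_less[symmetric])
  then show ?thesis
    using staircase_points_submonoid finite_subset by (auto simp: numerical_semigroup_def)
qed

lemma standard_basis_staircase_points:
  assumes "j < N" "b = eps j \<or> b = 2 * \<gamma> + 1 - eps j" "i = cell j b mod (2 * N)" "i \<noteq> 0"
  shows "standard_basis staircase_points (2 * N) i = cell j b"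
proof (rule antisym)
  let ?e = "standard_basis staircase_points (2 * N) i"
  have i: "0 < 2 * N" "0 < i" "i < 2 * N" using assms N_ge_3 by auto
  note e = standard_basis_properties[OF staircase_points_numerical i]
  have "admissible j b" using assms(2) eps_le[of j] by (auto simp: admissible_def)
  then have "cell j b \<in> staircase_points" using assms by (simp add: cell_in_staircase_points)
  moreover have "cell j b \<noteq> 0" using assms by (metis mod_0)
  ultimately show "?e \<le> cell j b" using assms by (intro e) auto
  obtain k c where kc: "?e = cell k c" "k < N" "admissible k c"
    using e(1) by (auto simp: staircase_points_def)
  then have "cell j b mod (2 * N) = cell k c mod (2 * N)" using e(3) assms by simp
  then have "k = j" "even (b + c)" using cell_mod_eq_iff assms kc by auto
  moreover have "b \<le> c"
  proof (cases "b = eps j")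
    case True
    then show ?thesis using admissible_ge_eps kc(3) \<open>k = j\<close> by simp
  next
    case False
    then have b: "b + eps j = 2 * \<gamma> + 1" using assms(2) eps_le[of j] by simp
    then have "odd (b + eps j)" by simp
    then have "odd (c + eps j)" using \<open>even (b + c)\<close> by auto
    then show ?thesis using kc(3) \<open>k = j\<close> b by (simp add: admissible_def)
  qed
  ultimately show "cell j b \<le> ?e" using kc cell_le_iff by simp
qed

lemma is_staircase_semigroup_staircase_points: "is_staircase_semigroup \<gamma> N t staircase_points"
proof -
  let ?e = "standard_basis staircase_points (2 * N)"
  have N: "N > 0" using N_ge_3 by simp
  have "admissible 0 2" by (simp add: admissible_def eps_0)
  then have two: "2 * N \<in> staircase_points"
    using cell_in_staircase_points[OF N, of 2] by (simp add: cell_def mult_2)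
  have eN: "?e N = (2 * \<gamma> + 1) * N"
    using standard_basis_staircase_points[OF N, of "2 * \<gamma> + 1" N] cell_mod[OF N, of "2 * \<gamma> + 1"] N
    by (simp add: eps_0) (simp add: cell_def mult.commute)
  have "min (?e (N - j)) (?e (2 * N - j)) = (N * t - 1) * j + N * eps j \<and>
      ?e (N - j) + ?e (2 * N - j) = 2 * j * (N * t - 1) + (2 * \<gamma> + 1) * N"
    if "j \<in> {1..N - 1}" for j
  proof -
    let ?l = "cell j (eps j)" and ?u = "cell j (2 * \<gamma> + 1 - eps j)"
    have j: "j < N" "0 < j" using that by auto
    obtain d where d: "2 * \<gamma> + 1 = eps j + d" using eps_le[of j] by (metis le_Suc_ex mult_2 trans_le_add1)
    have parity: "even (t * j + (2 * \<gamma> + 1 - eps j)) \<longleftrightarrow> odd (t * j + eps j)"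
      using d by (simp add: even_add) presburger
    have "?e (N - j) = ?l \<and> ?e (2 * N - j) = ?u \<or> ?e (N - j) = ?u \<and> ?e (2 * N - j) = ?l"
    proof -
      have basis: "?e (?l mod (2 * N)) = ?l" if "?l mod (2 * N) \<noteq> 0"
        using standard_basis_staircase_points[OF j(1), of "eps j"] that by blast
      have basis': "?e (?u mod (2 * N)) = ?u" if "?u mod (2 * N) \<noteq> 0"
        using standard_basis_staircase_points[OF j(1), of "2 * \<gamma> + 1 - eps j"] that by blast
      show ?thesis
        using basis basis' j parity unfolding cell_mod[OF j(1)] by (auto split: if_splits)
    qed
    moreover have "?l \<le> ?u" using eps_le[of j] by (simp add: cell_le_iff)
    moreover have l: "?l = (N * t - 1) * j + N * eps j"
    proof -
      obtain h where h: "N * t = Suc h" using N t_ge by (cases "N * t") auto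
      have "?l + j = N * t * j + N * eps j"
        using cell_plus[of j "eps j"] by (simp add: algebra_simps)
      then show ?thesis unfolding h by simp
    qed
    moreover have "?l + ?u = 2 * j * (N * t - 1) + (2 * \<gamma> + 1) * N"
    proof -
      have Nt: "N * t = Suc (N * t - 1)" using N t_ge by simp
      have "?l + ?u + 2 * j = 2 * j * (N * t) + (2 * \<gamma> + 1) * N"
        using cell_plus[of j "eps j"] cell_plus[of j d] d by (simp add: algebra_simps)
      also have "\<dots> = 2 * j * (N * t - 1) + (2 * \<gamma> + 1) * N + 2 * j"
        by (subst Nt) simp
      finally show ?thesis by simp
    qed
    ultimately show ?thesis by (auto simp: min_def)
  qed
  then show ?thesis
    using staircase_points_numerical two eN by (auto simp: is_staircase_semigroup_def Let_def)
qed

lemma staircase_semigroup_eq: "staircase_semigroup \<gamma> N t = staircase_points"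
  unfolding staircase_semigroup_def
  using is_staircase_semigroup_staircase_points is_staircase_semigroup_unique N_ge_3
  by (intro the_equality) auto

section \<open>The generators\<close>

definition generator_point :: "nat \<Rightarrow> nat \<Rightarrow> bool" where
  "generator_point j b \<longleftrightarrow>
     j = 0 \<and> b = 2 \<or> j = 0 \<and> b = 2 * \<gamma> + 1 \<or> j = 1 \<and> b = 1 \<or>
     1 \<le> j \<and> j \<le> \<gamma> \<and> b = 2 * \<gamma> + 1 - j \<or> \<gamma> < j \<and> j < N \<and> b = eps j"

lemma generator_pointD:
  assumes "generator_point j b"
  shows "j < N" "b \<le> 2 * \<gamma> + 1" "b > 0"
  using assms gamma_pos N_ge by (auto simp: generator_point_def staircase_eps_def)

lemma eps_small: "j \<le> \<gamma> \<Longrightarrow> eps j = j"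
  using N_ge by (simp add: staircase_eps_def)

lemma generator_point_admissible: "generator_point j b \<Longrightarrow> admissible j b"
  using gamma_pos eps_small[of j] eps_small[of 1] by (auto simp: generator_point_def admissible_def eps_0)

text \<open>
  Subtracting \<open>(0, 2)\<close> is possible unless \<open>b\<close> is one of the two prescribed heights. Of these, the
  lower ones with \<open>j > \<gamma>\<close> and the upper ones with \<open>j \<le> \<gamma>\<close> are generators. For the others one
  subtracts \<open>(1, 1)\<close>: the lower height increases by one at each \<open>j \<le> \<gamma>\<close>. The upper height
  \<open>2\<gamma> + 1 - \<epsilon>\<^sub>j\<close> increases where \<open>\<epsilon>\<close> decreases, so for \<open>j > N - \<gamma>\<close> it lies one above the upper
  height at \<open>j - 1\<close>; for \<open>\<gamma> < j \<le> N - \<gamma>\<close> it is \<open>\<gamma> + 1\<close>, one above the lower height at \<open>j - 1\<close>.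
\<close>

lemma generator_or_step:
  assumes "j < N" "admissible j b" "(j, b) \<noteq> (0, 0)"
  shows "generator_point j b \<or> (2 \<le> b \<and> admissible j (b - 2)) \<or>
    (1 \<le> j \<and> 1 \<le> b \<and> admissible (j - 1) (b - 1))"
proof (cases "2 \<le> b \<and> admissible j (b - 2)")
  case no_step: False
  have b: "b = eps j \<or> b = 2 * \<gamma> + 1 - eps j"
  proof (rule ccontr)
    assume other: "\<not> ?thesis"
    have "2 \<le> b \<and> (eps j \<le> b - 2 \<and> even (b + eps j) \<or> 2 * \<gamma> + 1 \<le> b - 2 + eps j)"
    proof (cases "even (b + eps j)")
      case True
      have "eps j < b" using other admissible_ge_eps[OF assms(2)] by simp
      with True have "eps j + 2 \<le> b"
        by (metis add_2_eq_Suc' even_Suc even_add le_neq_implies_less less_eq_Suc_le)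
      then have "2 \<le> b" "eps j \<le> b - 2" by auto
      then show ?thesis using True by blast
    next
      case False
      then have "2 * \<gamma> + 1 \<le> b + eps j" using assms(2) by (simp add: admissible_def)
      moreover have "b + eps j \<noteq> 2 * \<gamma> + 1" using other by auto
      moreover have "b + eps j \<noteq> 2 * \<gamma> + 2"
      proof
        assume "b + eps j = 2 * \<gamma> + 2"
        then have "even (b + eps j)" by simp
        then show False using False by simp
      qed
      ultimately have "2 * \<gamma> + 3 \<le> b + eps j" by linarith
      then show ?thesis using eps_le[of j] by auto
    qed
    then show False using no_step by (auto simp: admissible_def)
  qed
  show ?thesis
  proof (cases "j \<le> \<gamma>")
    case True
    then have eps: "eps j = j" "eps (j - 1) = j - 1" by (auto intro!: eps_small)
    from b show ?thesis
    proof
      assume "b = eps j"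
      then have "b = j" "1 \<le> j" using eps assms(3) by auto
      then have "admissible (j - 1) (b - 1)" using eps by (simp add: admissible_def)
      then show ?thesis using \<open>b = j\<close> \<open>1 \<le> j\<close> by blast
    next
      assume "b = 2 * \<gamma> + 1 - eps j"
      then have "generator_point j b" using True eps by (cases "j = 0") (simp_all add: generator_point_def)
      then show ?thesis ..
    qed
  next
    case False
    show ?thesis
    proof (cases "b = eps j")
      case True
      then show ?thesis using False assms by (simp add: generator_point_def)
    next
      case upper: False
      then have b: "b = 2 * \<gamma> + 1 - eps j" using b by simp
      have "eps (j - 1) = \<gamma> \<and> eps j = \<gamma> \<or> eps (j - 1) = eps j + 1"
        using False assms(1) gamma_pos N_ge by (auto simp: staircase_eps_def min_def)
      then have "admissible (j - 1) (b - 1)"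
      proof
        assume "eps (j - 1) = \<gamma> \<and> eps j = \<gamma>"
        then show ?thesis using b by (simp add: admissible_def)
      next
        assume "eps (j - 1) = eps j + 1"
        then show ?thesis using b eps_le[of j] by (simp add: admissible_def)
      qed
      moreover have "1 \<le> j" "1 \<le> b" using False b eps_le[of j] by auto
      ultimately show ?thesis by blast
    qed
  qed
qed simp

lemma generators_generate:
  "is_submonoid hull {cell j b | j b. generator_point j b} = staircase_points"
    (is "_ hull ?G = _")
proof
  have "?G \<subseteq> staircase_points"
    using cell_in_staircase_points generator_pointD generator_point_admissible by auto
  then show "is_submonoid hull ?G \<subseteq> staircase_points"
    using staircase_points_submonoid by (rule hull_minimal)
  have gen: "cell j b \<in> is_submonoid hull ?G" if "generator_point j b" for j b
    using that hull_inc[of "cell j b" ?G] by blast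
  have zero: "0 \<in> is_submonoid hull ?G"
    using is_submonoid_hull[of ?G] unfolding is_submonoid_def[of "is_submonoid hull ?G"] by blast
  have add: "x + y \<in> is_submonoid hull ?G"
    if "x \<in> is_submonoid hull ?G" "y \<in> is_submonoid hull ?G" for x y
    using is_submonoid_hull[of ?G] that unfolding is_submonoid_def[of "is_submonoid hull ?G"] by blast
  have "cell j b \<in> is_submonoid hull ?G" if "j < N" "admissible j b" for j b
    using that
  proof (induction b arbitrary: j rule: less_induct)
    case (less b)
    have points: "generator_point 0 2" "generator_point 1 1" by (auto simp: generator_point_def)
    consider "(j, b) = (0, 0)" | "generator_point j b" | "2 \<le> b" "admissible j (b - 2)"
      | "1 \<le> j" "1 \<le> b" "admissible (j - 1) (b - 1)"
      using generator_or_step less.prems by metis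
    then show ?case
    proof cases
      case 1
      then show ?thesis using zero by (simp add: cell_0_0)
    next
      case 2
      then show ?thesis by (rule gen)
    next
      case 3
      then have "cell 0 2 + cell j (b - 2) \<in> is_submonoid hull ?G"
        using less points gen by (intro add) auto
      then show ?thesis using 3 by (simp only: cell_add add_0 le_add_diff_inverse)
    next
      case 4
      then have "cell 1 1 + cell (j - 1) (b - 1) \<in> is_submonoid hull ?G"
        using less points gen by (intro add) auto
      then show ?thesis using 4 by (simp add: cell_add)
    qed
  qed
  then show "staircase_points \<subseteq> is_submonoid hull ?G" by (auto simp: staircase_points_def)
qed

text \<open>
  As every height is at least \<open>\<epsilon>\<close>, a lower point can only split where \<open>\<epsilon>\<close> is additive. This
  fails beyond \<open>\<gamma>\<close>; up to \<open>\<gamma>\<close>, where \<open>\<epsilon>\<^sub>j = j\<close>, the parity decides.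
\<close>

lemma generator_point_irreducible:
  assumes gen: "generator_point (k + l) (c + d)" and adm: "admissible k c" "admissible l d"
  shows "k = 0 \<and> c = 0 \<or> l = 0 \<and> d = 0"
proof (rule ccontr)
  assume nz: "\<not> (k = 0 \<and> c = 0 \<or> l = 0 \<and> d = 0)"
  have ge: "eps k \<le> c" "eps l \<le> d" using adm admissible_ge_eps by auto
  have lt: "k + l < N" using generator_pointD(1)[OF gen] .
  show False
  proof (cases "k + l \<le> \<gamma>")
    case True
    then have eps: "eps k = k" "eps l = l" by (auto intro!: eps_small)
    consider "k + l = 0" "c + d = 2" | "k + l = 1" "c + d = 1" | "c + d + (k + l) = 2 * \<gamma> + 1"
      using gen True by (auto simp: generator_point_def)
    then show False
    proof cases
      case 1
      then have "c = 1" "d = 1" using nz by auto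
      then show False using adm 1 eps gamma_pos by (simp add: admissible_def)
    next
      case 2
      then show False using nz ge eps by (cases "k = 0") auto
    next
      case 3
      \<comment> \<open>the total is odd, so one summand is as high as its upper point, which leaves \<open>(0, 0)\<close> for the other\<close>
      then have "odd (c + d + (k + l))" by simp
      then have "odd (c + k) \<or> odd (d + l)" by auto
      then have "2 * \<gamma> + 1 \<le> c + k \<or> 2 * \<gamma> + 1 \<le> d + l"
        using adm eps by (auto simp: admissible_def)
      then show False using 3 nz by auto
    qed
  next
    case False
    then have sum: "c + d = eps (k + l)" using gen gamma_pos by (auto simp: generator_point_def)
    show False
    proof (cases "k = 0 \<or> l = 0")
      case True
      then show False using sum ge nz by auto
    next
      case pos: False
      \<comment> \<open>beyond \<open>\<gamma>\<close> the triangle inequality for \<open>\<epsilon>\<close> is strict\<close>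
      have "eps (k + l) < eps k + eps l"
        using pos False lt N_ge gamma_pos by (auto simp: staircase_eps_def min_def)
      then show False using sum ge by linarith
    qed
  qed
qed

lemma generator_irreducible:
  assumes gen: "generator_point j b" and x: "x \<in> staircase_points" and y: "y \<in> staircase_points"
    and sum: "x + y = cell j b"
  shows "x = 0 \<or> y = 0"
proof -
  obtain k c l d where k: "x = cell k c" "k < N" "admissible k c"
    and l: "y = cell l d" "l < N" "admissible l d"
    using x y by (auto simp: staircase_points_def)
  have j: "j < N" "b \<le> 2 * \<gamma> + 1" using generator_pointD[OF gen] by auto
  have eq: "cell j b = cell (k + l) (c + d)" using sum k l cell_add by simp
  have "k + l < N"
  proof (rule ccontr)
    assume "\<not> k + l < N"
    then have "cell j b = cell (k + l - N) (c + d + t * N - 1)" "k + l - N < N"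
      using eq k l by (auto simp: cell_wrap)
    then have "b = c + d + t * N - 1" using j cell_eq_iff by auto
    then show False using tN_ge j by linarith
  qed
  then have "j = k + l" "b = c + d" using eq j cell_eq_iff by auto
  then show ?thesis
    using generator_point_irreducible gen k l cell_0_0 by metis
qed

lemma generators_minimal:
  "minimally_generated_by staircase_points {cell j b | j b. generator_point j b}"
proof (rule minimally_generated_by_irreducibles[OF staircase_points_submonoid generators_generate])
  show "0 \<notin> {cell j b | j b. generator_point j b}"
  proof
    assume "0 \<in> {cell j b | j b. generator_point j b}"
    then obtain j b where jb: "cell j b = cell 0 0" "generator_point j b" by (auto simp: cell_0_0)
    then show False using cell_eq_iff[of j 0 b 0] generator_pointD[OF jb(2)] by auto
  qed
next
  fix g x y
  assume "g \<in> {cell j b | j b. generator_point j b}" and xy: "x \<in> staircase_points" "y \<in> staircase_points"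
    and sum: "x + y = g"
  then obtain j b where "generator_point j b" "g = cell j b" by auto
  then show "x = 0 \<or> y = 0" using generator_irreducible[OF _ xy] sum by simp
qed

lemma family_A: "2 * N = cell 0 2" "(2 * \<gamma> + 1) * N = cell 0 (2 * \<gamma> + 1)" "N * (t + 1) - 1 = cell 1 1"
  by (simp_all add: cell_def)

lemma family_B:
  assumes "j \<le> \<gamma>"
  shows "N * (t - 1) * j - j + (2 * \<gamma> + 1) * N = cell j (2 * \<gamma> + 1 - j)"
proof -
  obtain u where u: "t = Suc u" "u > 0" using t_ge by (cases t) auto
  obtain d where d: "2 * \<gamma> + 1 = j + d" using assms by (metis le_Suc_ex mult_2 trans_le_add1)
  have "j \<le> N * u * j" using u N_ge_3 by simp
  moreover have "N * u * j + (j + d) * N = N * (t * j + d)"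
    using u by (simp add: algebra_simps)
  moreover have "N * (t - 1) * j = N * u * j" using u by simp
  ultimately have "N * (t - 1) * j - j + (2 * \<gamma> + 1) * N + j = N * (t * j + d)"
    unfolding d by linarith
  also have "\<dots> = cell j d + j" by (simp only: cell_plus)
  finally have "N * (t - 1) * j - j + (2 * \<gamma> + 1) * N = cell j d" by (rule add_right_imp_eq)
  moreover have "d = 2 * \<gamma> + 1 - j" using d by simp
  ultimately show ?thesis by simp
qed

lemma family_C: "N * t * j + N * \<gamma> - j = cell j \<gamma>"
  by (simp add: cell_def algebra_simps)

lemma family_D:
  assumes "j < N"
  shows "N * (t - 1) * j + N ^ 2 - j = cell j (N - j)"
proof -
  obtain u where u: "t = Suc u" using t_ge by (cases t) auto
  obtain d where d: "N = j + d" using assms less_imp_add_positive by blast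
  have "N * (t - 1) * j + N ^ 2 = N * (t * j + (N - j))"
    using u d by (simp add: algebra_simps power2_eq_square)
  then show ?thesis by (simp add: cell_def)
qed

end

theorem proposition5p15:
  fixes \<gamma> t N :: nat
  assumes "\<gamma> > 0" and "t \<ge> 2 * \<gamma> + 3" and "N \<ge> 3 * \<gamma>"
  shows "let A = {2 * N, (2 * \<gamma> + 1) * N, N * (t + 1) - 1};
             B = (\<lambda>j. N * (t - 1) * j - j + (2 * \<gamma> + 1) * N) ` {1..\<gamma>};
             C = (\<lambda>j. N * t * j + N * \<gamma> - j) ` {\<gamma> + 1..N - \<gamma>};
             D = (\<lambda>j. N * (t - 1) * j + N ^ 2 - j) ` {N - \<gamma> + 1..N - 1}
         in A \<inter> B = {} \<and> A \<inter> C = {} \<and> A \<inter> D = {} \<and> B \<inter> C = {} \<and> B \<inter> D = {} \<and> C \<inter> D = {} \<and>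
            minimally_generated_by (staircase_semigroup \<gamma> N t) (A \<union> B \<union> C \<union> D)"
proof -
  interpret staircase_parameters \<gamma> t N
    using assms by unfold_locales
  let ?A = "{cell 0 2, cell 0 (2 * \<gamma> + 1), cell 1 1}"
  let ?B = "(\<lambda>j. cell j (2 * \<gamma> + 1 - j)) ` {1..\<gamma>}"
  let ?C = "(\<lambda>j. cell j \<gamma>) ` {\<gamma> + 1..N - \<gamma>}"
  let ?D = "(\<lambda>j. cell j (N - j)) ` {N - \<gamma> + 1..N - 1}"
  have A: "{2 * N, (2 * \<gamma> + 1) * N, N * (t + 1) - 1} = ?A"
    by (simp only: family_A)
  have B: "(\<lambda>j. N * (t - 1) * j - j + (2 * \<gamma> + 1) * N) ` {1..\<gamma>} = ?B"
    using family_B by (intro image_cong) auto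
  have C: "(\<lambda>j. N * t * j + N * \<gamma> - j) ` {\<gamma> + 1..N - \<gamma>} = ?C"
    by (simp only: family_C)
  have D: "(\<lambda>j. N * (t - 1) * j + N ^ 2 - j) ` {N - \<gamma> + 1..N - 1} = ?D"
    using N_ge_3 by (intro image_cong family_D) auto
  have lower: "eps j = (if j \<le> N - \<gamma> then \<gamma> else N - j)" if "\<gamma> < j" for j
    using that by (auto simp: staircase_eps_def)
  have union: "?A \<union> ?B \<union> ?C \<union> ?D = {cell j b | j b. generator_point j b}"
  proof
    show "?A \<union> ?B \<union> ?C \<union> ?D \<subseteq> {cell j b | j b. generator_point j b}"
    proof -
      have "generator_point 0 2" "generator_point 0 (2 * \<gamma> + 1)" "generator_point 1 1"
        by (simp_all add: generator_point_def)
      moreover have "generator_point j (2 * \<gamma> + 1 - j)" if "j \<in> {1..\<gamma>}" for j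
        using that by (simp add: generator_point_def)
      moreover have "generator_point j \<gamma>" if "j \<in> {\<gamma> + 1..N - \<gamma>}" for j
        using that lower[of j] gamma_pos by (auto simp: generator_point_def)
      moreover have "generator_point j (N - j)" if "j \<in> {N - \<gamma> + 1..N - 1}" for j
        using that lower[of j] gamma_pos N_ge by (auto simp: generator_point_def)
      ultimately show ?thesis by blast
    qed
    show "{cell j b | j b. generator_point j b} \<subseteq> ?A \<union> ?B \<union> ?C \<union> ?D"
    proof
      fix x assume "x \<in> {cell j b | j b. generator_point j b}"
      then obtain j b where x: "x = cell j b" and "generator_point j b" by blast
      then consider "x \<in> ?A" | "j \<in> {1..\<gamma>}" "b = 2 * \<gamma> + 1 - j"
        | "j \<in> {\<gamma> + 1..N - \<gamma>}" "b = \<gamma>" | "j \<in> {N - \<gamma> + 1..N - 1}" "b = N - j"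
        using lower[of j] unfolding generator_point_def by (auto split: if_splits)
      then show "x \<in> ?A \<union> ?B \<union> ?C \<union> ?D" using x by cases blast+
    qed
  qed
  have disjoint: "?A \<inter> ?B = {}" "?A \<inter> ?C = {}" "?A \<inter> ?D = {}"
      "?B \<inter> ?C = {}" "?B \<inter> ?D = {}" "?C \<inter> ?D = {}"
    using N_ge gamma_pos by (auto simp: cell_eq_iff)
  show ?thesis
    unfolding Let_def A B C D union staircase_semigroup_eq
    using disjoint generators_minimal by blast
qed

end
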